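(* Let $y\in\mathbb{R}^n$, $X\in\mathbb{R}^{n\times p}$, $\lambda>0$, let $\mathcal{E}$ and $s$ be the equicorrelation set and signs at $y,X,\lambda$, and let $$K=\{x\in\mathbb{R}^{|\mathcal{E}|}: Px=\hat\beta^{\mathrm{LARS}}_{\mathcal{E}},\; Sx\ge0\},$$ where $P$ is the orthogonal projection onto the row space of $X_{\mathcal{E}}$, $S=\mathrm{diag}(s)$, and $\hat\beta^{\mathrm{LARS}}_{\mathcal{E}}=(X_{\mathcal{E}})^+(y-(X_{\mathcal{E}}^T)^+\lambda s)$. Then $K$ is a convex polytope, and the set of lasso solutions at $y,X,\lambda$ is exactly the set of $\hat\beta\in\mathbb{R}^p$ with $\hat\beta_{-\mathcal{E}}=0$ and $\hat\beta_{\mathcal{E}}\in K$. Moreover, for each $i\in\mathcal{E}$, with $$\hat\beta_i^{\mathrm{lower}}=\min_{x\in K}x_i,\qquad \hat\beta_i^{\mathrm{upper}}=\max_{x\in K}x_i,$$ every lasso solution $\hat\beta$ satisfies $\hat\beta_i\in[\hat\beta_i^{\mathrm{lower}},\hat\beta_i^{\mathrm{upper}}]$, each of the two bounds is achieved by the $i$th component of some lasso solution, and every value between $\hat\beta_i^{\mathrm{lower}}$ and $\hat\beta_i^{\mathrm{upper}}$ is achieved by the $i$th component of some lasso solution.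
   Context: A lasso solution at $y,X,\lambda$ is a minimizer of $\frac12\|y-X\beta\|_2^2+\lambda\|\beta\|_1$ over $\beta\in\mathbb{R}^p$. All lasso solutions at $y,X,\lambda$ have the same fitted value $X\hat\beta$. The equicorrelation set is $\mathcal{E}=\{i\in\{1,\dots,p\}: |X_i^T(y-X\hat\beta)|=\lambda\}$, and the equicorrelation signs are $s=\mathrm{sign}(X_{\mathcal{E}}^T(y-X\hat\beta))\in\{-1,1\}^{|\mathcal{E}|}$, for any lasso solution $\hat\beta$. Notation: $A^+$ is the Moore-Penrose pseudoinverse; $X_i$ is the $i$th column of $X$; $X_{\mathcal{E}}$ is the submatrix of columns with index in $\mathcal{E}$; $\beta_{\mathcal{E}}$ and $\beta_{-\mathcal{E}}$ are the subvectors of $\beta$ with coordinates in, respectively not in, $\mathcal{E}$; coordinates of $\mathbb{R}^{|\mathcal{E}|}$ are indexed by $\mathcal{E}$; inequalities between vectors are componentwise. *)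

theory Defs
  imports "HOL-Analysis.Analysis"
begin

definition lasso_objective ::
    "real ^ 'n \<Rightarrow> real ^ 'p ^ 'n \<Rightarrow> real \<Rightarrow> real ^ 'p \<Rightarrow> real" where
  "lasso_objective y X lam \<beta> =
     1 / 2 * (norm (y - X *v \<beta>))\<^sup>2 + lam * (\<Sum>i\<in>UNIV. \<bar>\<beta> $ i\<bar>)"

definition lasso_solution ::
    "real ^ 'n \<Rightarrow> real ^ 'p ^ 'n \<Rightarrow> real \<Rightarrow> real ^ 'p \<Rightarrow> bool" where
  "lasso_solution y X lam \<beta> \<longleftrightarrow>
     (\<forall>\<beta>'. lasso_objective y X lam \<beta> \<le> lasso_objective y X lam \<beta>')"

(* The fitted value is the same for all lasso solutions. *)
definition lasso_fit :: "real ^ 'n \<Rightarrow> real ^ 'p ^ 'n \<Rightarrow> real \<Rightarrow> real ^ 'n" where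
  "lasso_fit y X lam = (THE f. \<exists>\<beta>. lasso_solution y X lam \<beta> \<and> f = X *v \<beta>)"

definition equicorrelation_set ::
    "real ^ 'n \<Rightarrow> real ^ 'p ^ 'n \<Rightarrow> real \<Rightarrow> 'p set" where
  "equicorrelation_set y X lam =
     {i. \<bar>column i X \<bullet> (y - lasso_fit y X lam)\<bar> = lam}"

(* The index set E depends on the data, so it cannot be the index type of a vector.
   R^|E|, with coordinates indexed by E, is represented by the subspace coord_space E
   of R^p of vectors vanishing outside E. Correspondingly the submatrix X_E keeps its
   p columns, those outside E being set to zero. Since zero columns of A become zero
   rows of the pseudoinverse of A (and vice versa), and do not affect the row space
   inside coord_space E, all operations below agree with those on the genuine submatrix;
   this includes the case of empty E, where coord_space E = {0}. *)

definition coord_space :: "'p set \<Rightarrow> (real ^ 'p) set" where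
  "coord_space E = {x. \<forall>i. i \<notin> E \<longrightarrow> x $ i = 0}"

definition subvec :: "'p set \<Rightarrow> real ^ 'p \<Rightarrow> real ^ 'p" where
  "subvec E x = (\<chi> i. if i \<in> E then x $ i else 0)"

definition subcols :: "'p set \<Rightarrow> real ^ 'p ^ 'n \<Rightarrow> real ^ 'p ^ 'n" where
  "subcols E X = (\<chi> k i. if i \<in> E then X $ k $ i else 0)"

definition equicorrelation_signs ::
    "real ^ 'n \<Rightarrow> real ^ 'p ^ 'n \<Rightarrow> real \<Rightarrow> real ^ 'p" where
  "equicorrelation_signs y X lam =
     (let E = equicorrelation_set y X lam;
          c = transpose (subcols E X) *v (y - lasso_fit y X lam)
      in (\<chi> i. sgn (c $ i)))"

(* The Moore-Penrose pseudoinverse: the unique matrix satisfying the Penrose conditions. *)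
definition pinv :: "real ^ 'c ^ 'r \<Rightarrow> real ^ 'r ^ 'c" where
  "pinv A = (THE B. A ** B ** A = A \<and> B ** A ** B = B \<and>
                    transpose (A ** B) = A ** B \<and> transpose (B ** A) = B ** A)"

definition row_space :: "real ^ 'c ^ 'r \<Rightarrow> (real ^ 'c) set" where
  "row_space A = span (rows A)"

(* Intended for subspaces V. *)
definition orthogonal_projection :: "'a::euclidean_space set \<Rightarrow> 'a \<Rightarrow> 'a" where
  "orthogonal_projection V x = (THE z. z \<in> V \<and> (\<forall>v\<in>V. orthogonal (x - z) v))"

definition diag_matrix :: "real ^ 'p \<Rightarrow> real ^ 'p ^ 'p" where
  "diag_matrix d = (\<chi> i j. if i = j then d $ i else 0)"

definition lars_coeffs ::
    "real ^ 'n \<Rightarrow> real ^ 'p ^ 'n \<Rightarrow> real \<Rightarrow> real ^ 'p" where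
  "lars_coeffs y X lam =
     (let XE = subcols (equicorrelation_set y X lam) X;
          s = equicorrelation_signs y X lam
      in pinv XE *v (y - pinv (transpose XE) *v (lam *\<^sub>R s)))"

definition lasso_polytope ::
    "real ^ 'n \<Rightarrow> real ^ 'p ^ 'n \<Rightarrow> real \<Rightarrow> (real ^ 'p) set" where
  "lasso_polytope y X lam =
     (let E = equicorrelation_set y X lam;
          S = diag_matrix (equicorrelation_signs y X lam)
      in {x \<in> coord_space E.
            orthogonal_projection (row_space (subcols E X)) x = lars_coeffs y X lam
            \<and> 0 \<le> S *v x})"

definition lasso_lower ::
    "real ^ 'n \<Rightarrow> real ^ 'p ^ 'n \<Rightarrow> real \<Rightarrow> 'p \<Rightarrow> real" where
  "lasso_lower y X lam i = (LEAST t. t \<in> (\<lambda>x. x $ i) ` lasso_polytope y X lam)"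

definition lasso_upper ::
    "real ^ 'n \<Rightarrow> real ^ 'p ^ 'n \<Rightarrow> real \<Rightarrow> 'p \<Rightarrow> real" where
  "lasso_upper y X lam i = (GREATEST t. t \<in> (\<lambda>x. x $ i) ` lasso_polytope y X lam)"

end

theory Submission
  imports Defs
begin

text \<open>
  The polytope \<^term>\<open>lasso_polytope y X lam\<close> is literally the set of lasso solutions
  (\<open>lasso_polytope_eq_solutions\<close>); everything else follows from this.

  Since the lasso objective is convex, a vector \<open>\<beta>\<close> is a minimizer iff zero is a subgradient
  at \<open>\<beta>\<close> (\<open>lasso_solution_iff_kkt\<close>). This condition involves \<open>\<beta>\<close> only through its coordinates
  and the inner products of the columns of \<open>X\<close> with the residual \<open>y - X \<beta>\<close>. The residual is
  the same for all solutions, because the quadratic part of the objective is strictly convex in the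
  fitted value (\<open>lasso_fit_unique\<close>). Hence, once one solution \<open>\<beta>\<^sub>0\<close> is known, the inner
  products are constants and the solutions are the vectors supported in the equicorrelation set
  that have the fitted value \<open>X \<beta>\<^sub>0\<close> and whose coordinates have the equicorrelation signs
  (\<open>lasso_solution_iff_fixed_fit\<close>).

  It remains to recognise the condition on the fitted value as the projection condition in the
  definition of the polytope. Let \<open>A\<close> be the submatrix of equicorrelated columns. On it,
  \<open>lam s = A\<^sup>T (y - A \<beta>\<^sub>0)\<close>, and the Penrose identities collapse the LARS coefficients to
  \<open>A\<^sup>+ A \<beta>\<^sub>0\<close> (\<open>lars_coeffs_eq\<close>). As \<open>A\<^sup>+ A\<close> is the projection onto the row space,
  \<open>P x = A\<^sup>+ A \<beta>\<^sub>0\<close> says \<open>A\<^sup>+ A x = A\<^sup>+ A \<beta>\<^sub>0\<close>, which is equivalent to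
  \<open>A x = A \<beta>\<^sub>0\<close>.

  The solution set is then cut out by linear equations and inequalities; it is bounded since the
  \<open>l\<^sub>1\<close> penalty is coercive, and nonempty since the objective attains its minimum. So it is
  a nonempty polytope, and its projection to a coordinate axis is a nonempty compact interval,
  whose endpoints are the bounds in the theorem.
\<close>

section \<open>Optimality conditions for the lasso\<close>

lemma inner_matrix_vector_columns:
  fixes A :: "real ^ 'p ^ 'n"
  shows "r \<bullet> (A *v v) = (\<Sum>i\<in>UNIV. (column i A \<bullet> r) * v $ i)"
  unfolding matrix_mult_sum scalar_mult_eq_scaleR inner_sum_right inner_scaleR_right
  by (simp add: inner_commute mult.commute)

text \<open>
  The exact second-order expansion of the objective around \<open>\<beta>\<close>. Both directions of the
  optimality criterion come from it: the last sum splits over the coordinates, so its terms can be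
  estimated, or singled out by a step along one coordinate axis.
\<close>

lemma lasso_objective_excess:
  fixes X :: "real ^ 'p ^ 'n"
  shows "lasso_objective y X lam \<beta>' = lasso_objective y X lam \<beta>
    + 1 / 2 * (norm (X *v (\<beta>' - \<beta>)))\<^sup>2
    + (\<Sum>i\<in>UNIV. lam * (\<bar>\<beta>' $ i\<bar> - \<bar>\<beta> $ i\<bar>)
         - (column i X \<bullet> (y - X *v \<beta>)) * (\<beta>' - \<beta>) $ i)"
proof -
  define r where "r = y - X *v \<beta>"
  have "y - X *v \<beta>' = r - X *v (\<beta>' - \<beta>)"
    by (simp add: r_def matrix_vector_mult_diff_distrib)
  then have "(norm (y - X *v \<beta>'))\<^sup>2
      = (norm r)\<^sup>2 - 2 * (r \<bullet> (X *v (\<beta>' - \<beta>))) + (norm (X *v (\<beta>' - \<beta>)))\<^sup>2"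
    unfolding power2_norm_eq_inner by (simp add: inner_diff inner_commute)
  then show ?thesis
    unfolding lasso_objective_def r_def[symmetric] inner_matrix_vector_columns
    by (simp add: sum_subtractf right_diff_distrib flip: sum_distrib_left)
qed

text \<open>
  For each \<open>i\<close> the two conditions say that \<open>column i X \<bullet> (y - X *v \<beta>)\<close> is a subgradient of
  \<open>b \<mapsto> lam * \<bar>b\<bar>\<close> at \<open>\<beta> $ i\<close>. Writing them without a case distinction on the sign of
  \<open>\<beta> $ i\<close> lets them be summed and scaled directly.
\<close>

definition lasso_kkt ::
    "real ^ 'n \<Rightarrow> real ^ 'p ^ 'n \<Rightarrow> real \<Rightarrow> real ^ 'p \<Rightarrow> bool" where
  "lasso_kkt y X lam \<beta> \<longleftrightarrow>
     (\<forall>i. \<bar>column i X \<bullet> (y - X *v \<beta>)\<bar> \<le> lam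
        \<and> (column i X \<bullet> (y - X *v \<beta>)) * \<beta> $ i = lam * \<bar>\<beta> $ i\<bar>)"

text \<open>
  The quadratic term on the left does more than show that \<open>\<beta>\<close> is a minimizer: it forces any
  other minimizer to have the same fitted value.
\<close>

lemma lasso_kkt_excess:
  assumes "lasso_kkt y X lam \<beta>"
  shows "lasso_objective y X lam \<beta> + 1 / 2 * (norm (X *v (\<beta>' - \<beta>)))\<^sup>2
    \<le> lasso_objective y X lam \<beta>'"
proof -
  have "0 \<le> lam * (\<bar>\<beta>' $ i\<bar> - \<bar>\<beta> $ i\<bar>)
         - (column i X \<bullet> (y - X *v \<beta>)) * (\<beta>' - \<beta>) $ i" for i
  proof -
    define g where "g = column i X \<bullet> (y - X *v \<beta>)"
    have "\<bar>g\<bar> \<le> lam" and eq: "g * \<beta> $ i = lam * \<bar>\<beta> $ i\<bar>"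
      using assms by (auto simp: lasso_kkt_def g_def)
    then have "\<bar>g\<bar> * \<bar>\<beta>' $ i\<bar> \<le> lam * \<bar>\<beta>' $ i\<bar>"
      by (intro mult_right_mono) auto
    then have "g * \<beta>' $ i \<le> lam * \<bar>\<beta>' $ i\<bar>"
      using abs_ge_self[of "g * \<beta>' $ i"] by (simp add: abs_mult)
    with eq show ?thesis by (simp add: g_def[symmetric] right_diff_distrib)
  qed
  then show ?thesis
    unfolding lasso_objective_excess[of y X lam \<beta>' \<beta>] by (simp add: sum_nonneg)
qed

text \<open>
  Dividing by \<open>t\<close> and letting \<open>t\<close> tend to zero: the first-order part of an inequality that holds
  for small steps.
\<close>

lemma nonpos_if_linear_le_quadratic:
  fixes a c :: real
  assumes "\<And>t. 0 < t \<Longrightarrow> t < 1 \<Longrightarrow> t * a \<le> t\<^sup>2 * c"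
  shows "a \<le> 0"
proof (rule tendsto_lowerbound)
  show "((\<lambda>t. t * c) \<longlongrightarrow> 0) (at_right 0)"
    by (auto intro!: tendsto_eq_intros)
  have "\<forall>\<^sub>F t in at_right 0. (0::real) < t \<and> t < 1"
    using eventually_at_right_real[of 0 1] by (auto elim: eventually_mono)
  then show "\<forall>\<^sub>F t in at_right 0. a \<le> t * c"
  proof eventually_elim
    case (elim t)
    with assms[of t] show ?case by (simp add: power2_eq_square mult.assoc)
  qed
qed auto

lemma lasso_solution_coordinate_step:
  fixes X :: "real ^ 'p ^ 'n"
  assumes "lasso_solution y X lam \<beta>"
  shows "(column i X \<bullet> (y - X *v \<beta>)) * t
    \<le> 1 / 2 * t\<^sup>2 * (norm (column i X))\<^sup>2 + lam * (\<bar>\<beta> $ i + t\<bar> - \<bar>\<beta> $ i\<bar>)"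
proof -
  have "X *v (axis i t) = t *\<^sub>R column i X"
    unfolding matrix_mult_sum scalar_mult_eq_scaleR
    by (simp add: axis_def if_distrib[of "\<lambda>c. c *\<^sub>R _"] cong: if_cong)
  moreover have "(\<Sum>j\<in>UNIV. lam * (\<bar>(\<beta> + axis i t) $ j\<bar> - \<bar>\<beta> $ j\<bar>)
         - (column j X \<bullet> (y - X *v \<beta>)) * (\<beta> + axis i t - \<beta>) $ j)
     = (\<Sum>j\<in>UNIV. if j = i then lam * (\<bar>\<beta> $ i + t\<bar> - \<bar>\<beta> $ i\<bar>)
         - (column i X \<bullet> (y - X *v \<beta>)) * t else 0)"
    by (intro sum.cong) (auto simp: axis_def)
  moreover have "lasso_objective y X lam \<beta> \<le> lasso_objective y X lam (\<beta> + axis i t)"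
    using assms by (simp add: lasso_solution_def)
  ultimately show ?thesis
    unfolding lasso_objective_excess[of y X lam "\<beta> + axis i t" \<beta>]
    by (simp add: power_mult_distrib)
qed

text \<open>
  Only steps along single coordinates are needed. A step \<open>t\<close> of either sign bounds the gradient,
  since the penalty grows by at most \<open>lam * \<bar>t\<bar>\<close>; a step that shrinks \<open>\<beta> $ i\<close> towards zero
  lowers the penalty by exactly \<open>t * lam * \<bar>\<beta> $ i\<bar>\<close> and gives the missing inequality in the
  complementarity condition.
\<close>

lemma lasso_solution_imp_kkt:
  fixes X :: "real ^ 'p ^ 'n"
  assumes sol: "lasso_solution y X lam \<beta>" and "0 \<le> lam"
  shows "lasso_kkt y X lam \<beta>"
  unfolding lasso_kkt_def
proof
  fix i
  define g where "g = column i X \<bullet> (y - X *v \<beta>)"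
  define c where "c = (norm (column i X))\<^sup>2 / 2"
  have step: "g * t \<le> t\<^sup>2 * c + lam * (\<bar>\<beta> $ i + t\<bar> - \<bar>\<beta> $ i\<bar>)" for t
    using lasso_solution_coordinate_step[OF sol, of i t] by (simp add: g_def c_def)
  have le: "g * t \<le> t\<^sup>2 * c + lam * \<bar>t\<bar>" for t
  proof -
    have "lam * (\<bar>\<beta> $ i + t\<bar> - \<bar>\<beta> $ i\<bar>) \<le> lam * \<bar>t\<bar>"
      using \<open>0 \<le> lam\<close> by (intro mult_left_mono) auto
    with step[of t] show ?thesis by linarith
  qed
  have "g - lam \<le> 0"
  proof (rule nonpos_if_linear_le_quadratic[of _ c])
    fix t :: real assume "0 < t" "t < 1"
    then show "t * (g - lam) \<le> t\<^sup>2 * c" using le[of t] by (simp add: algebra_simps)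
  qed
  moreover have "- g - lam \<le> 0"
  proof (rule nonpos_if_linear_le_quadratic[of _ c])
    fix t :: real assume "0 < t" "t < 1"
    then show "t * (- g - lam) \<le> t\<^sup>2 * c" using le[of "- t"] by (simp add: algebra_simps)
  qed
  ultimately have bound: "\<bar>g\<bar> \<le> lam" by linarith
  have "lam * \<bar>\<beta> $ i\<bar> - g * \<beta> $ i \<le> 0"
  proof (rule nonpos_if_linear_le_quadratic[of _ "(\<beta> $ i)\<^sup>2 * c"])
    fix t :: real assume t: "0 < t" "t < 1"
    then have eq: "\<bar>\<beta> $ i + - t * \<beta> $ i\<bar> - \<bar>\<beta> $ i\<bar> = - t * \<bar>\<beta> $ i\<bar>"
      using abs_mult[of "1 - t" "\<beta> $ i"] by (simp add: left_diff_distrib)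
    then show "t * (lam * \<bar>\<beta> $ i\<bar> - g * \<beta> $ i) \<le> t\<^sup>2 * ((\<beta> $ i)\<^sup>2 * c)"
      using step[of "- t * \<beta> $ i"] unfolding eq by (simp add: power_mult_distrib algebra_simps)
  qed
  moreover have "g * \<beta> $ i \<le> lam * \<bar>\<beta> $ i\<bar>"
    using mult_right_mono[OF bound abs_ge_zero[of "\<beta> $ i"]] abs_ge_self[of "g * \<beta> $ i"]
    by (simp add: abs_mult)
  ultimately have "g * \<beta> $ i = lam * \<bar>\<beta> $ i\<bar>" by linarith
  with bound show "\<bar>column i X \<bullet> (y - X *v \<beta>)\<bar> \<le> lam
        \<and> (column i X \<bullet> (y - X *v \<beta>)) * \<beta> $ i = lam * \<bar>\<beta> $ i\<bar>"
    by (simp add: g_def)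
qed

lemma lasso_solution_iff_kkt:
  assumes "0 \<le> lam"
  shows "lasso_solution y X lam \<beta> \<longleftrightarrow> lasso_kkt y X lam \<beta>"
proof
  assume "lasso_kkt y X lam \<beta>"
  have "lasso_objective y X lam \<beta> \<le> lasso_objective y X lam \<beta>'" for \<beta>'
    using lasso_kkt_excess[OF \<open>lasso_kkt y X lam \<beta>\<close>, of \<beta>'] zero_le_power2[of "norm (X *v (\<beta>' - \<beta>))"]
    by linarith
  then show "lasso_solution y X lam \<beta>" by (simp add: lasso_solution_def)
qed (rule lasso_solution_imp_kkt[OF _ assms])

lemma lasso_fit_unique:
  assumes "0 \<le> lam" "lasso_solution y X lam \<beta>" "lasso_solution y X lam \<beta>'"
  shows "X *v \<beta>' = X *v \<beta>"
proof -
  have "lasso_objective y X lam \<beta>' \<le> lasso_objective y X lam \<beta>"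
    using assms(3) by (simp add: lasso_solution_def)
  with lasso_kkt_excess[OF lasso_solution_imp_kkt[OF assms(2,1)], of \<beta>']
  have "(norm (X *v (\<beta>' - \<beta>)))\<^sup>2 \<le> 0" by linarith
  then show ?thesis by (simp add: matrix_vector_mult_diff_distrib)
qed

lemma norm_le_lasso_objective:
  assumes "0 \<le> lam"
  shows "lam * norm \<beta> \<le> lasso_objective y X lam \<beta>"
proof -
  have "lam * norm \<beta> \<le> lam * (\<Sum>i\<in>UNIV. \<bar>\<beta> $ i\<bar>)"
    using norm_le_l1_cart[of \<beta>] assms by (intro mult_left_mono)
  then show ?thesis by (simp add: lasso_objective_def add_increasing)
qed

text \<open>
  Outside the ball of radius \<open>R\<close> the penalty alone exceeds the objective at zero, so a
  minimizer over this compact ball is a global one.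
\<close>

lemma lasso_solution_exists:
  fixes X :: "real ^ 'p ^ 'n"
  assumes "0 < lam"
  shows "\<exists>\<beta>. lasso_solution y X lam \<beta>"
proof -
  define R where "R = lasso_objective y X lam 0 / lam"
  have "0 \<le> R"
    using norm_le_lasso_objective[of lam "0 :: real ^ 'p" y X] assms by (simp add: R_def)
  have "continuous_on (cball 0 R) (lasso_objective y X lam)"
    unfolding lasso_objective_def
    by (intro continuous_intros linear_continuous_on matrix_vector_mul_bounded_linear)
  then obtain \<beta> where min: "\<And>\<beta>'. \<beta>' \<in> cball 0 R \<Longrightarrow>
      lasso_objective y X lam \<beta> \<le> lasso_objective y X lam \<beta>'"
    using continuous_attains_inf[of "cball 0 R" "lasso_objective y X lam"] \<open>0 \<le> R\<close>
    by fastforce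
  have "lasso_objective y X lam \<beta> \<le> lasso_objective y X lam \<beta>'" for \<beta>'
  proof (cases "\<beta>' \<in> cball 0 R")
    case False
    then have "lasso_objective y X lam 0 \<le> lam * norm \<beta>'"
      using assms by (simp add: R_def field_simps)
    then show ?thesis
      using min[of 0] \<open>0 \<le> R\<close> norm_le_lasso_objective[of lam \<beta>' y X] assms by simp
  qed (rule min)
  then show ?thesis by (auto simp: lasso_solution_def)
qed

lemma lasso_fit_eq:
  assumes "0 \<le> lam" "lasso_solution y X lam \<beta>"
  shows "lasso_fit y X lam = X *v \<beta>"
  unfolding lasso_fit_def using assms lasso_fit_unique by (intro the_equality) blast+

section \<open>The pseudoinverse and the projection onto the row space\<close>

lemma transpose_mult_in_row_space: "transpose A *v w \<in> row_space A"
  using matrix_vector_mult_in_columnspace[of "transpose A" w]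
  by (simp only: row_space_def columns_transpose)

lemma mult_eq_0_if_orthogonal_row_space:
  fixes A :: "real ^ 'c ^ 'r"
  assumes "\<And>v. v \<in> row_space A \<Longrightarrow> u \<bullet> v = 0"
  shows "A *v u = 0"
proof -
  have "(A *v u) \<bullet> (A *v u) = u \<bullet> (transpose A *v (A *v u))"
    by (metis dot_lmul_matrix inner_commute transpose_matrix_vector)
  also have "\<dots> = 0" by (rule assms[OF transpose_mult_in_row_space])
  finally show ?thesis by simp
qed

lemma inner_row_space_eq_0:
  fixes A :: "real ^ 'c ^ 'r"
  assumes "A *v u = 0" "v \<in> row_space A"
  shows "u \<bullet> v = 0"
proof -
  have "orthogonal u r" if "r \<in> rows A" for r
  proof -
    from that obtain k where "r = row k A" by (auto simp: rows_def)
    then have "r \<bullet> u = (A *v u) $ k" by (simp add: matrix_mult_dot row_def)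
    with assms(1) show ?thesis by (simp add: orthogonal_def inner_commute)
  qed
  with assms(2) show ?thesis
    unfolding row_space_def using orthogonal_to_span[of v "rows A" u]
    by (auto simp: orthogonal_def)
qed

lemma transpose_eq_self_iff:
  fixes M :: "real ^ 'n ^ 'n"
  shows "transpose M = M \<longleftrightarrow> (\<forall>u w. (M *v u) \<bullet> w = u \<bullet> (M *v w))"
proof
  assume "\<forall>u w. (M *v u) \<bullet> w = u \<bullet> (M *v w)"
  then have "(transpose M *v w - M *v w) \<bullet> u = 0" for u w
    by (simp add: inner_diff_left dot_lmul_matrix)
  then have "transpose M *v w = M *v w" for w
    by (metis eq_iff_diff_eq_0 inner_eq_zero_iff)
  then show "transpose M = M" unfolding matrix_eq by blast
qed (metis dot_lmul_matrix transpose_matrix_vector)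

definition is_pinv :: "real ^ 'c ^ 'r \<Rightarrow> real ^ 'r ^ 'c \<Rightarrow> bool" where
  "is_pinv A B \<longleftrightarrow> A ** B ** A = A \<and> B ** A ** B = B \<and>
     transpose (A ** B) = A ** B \<and> transpose (B ** A) = B ** A"

text \<open>
  If \<open>B\<close> and \<open>C\<close> are both pseudoinverses, then \<open>A B = A C\<close>, as both are the orthogonal
  projection onto the column space; algebraically, each absorbs the other from one side, and
  transposition exchanges the sides. In the same way \<open>B A = C A\<close>.
\<close>

lemma is_pinv_unique:
  assumes B: "is_pinv A B" and C: "is_pinv A C"
  shows "B = C"
proof -
  have "A ** B = A ** C ** (A ** B)"
    using C by (simp add: is_pinv_def matrix_mul_assoc)
  also have "\<dots> = transpose (A ** B ** (A ** C))"
    using B C by (simp add: is_pinv_def matrix_transpose_mul)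
  also have "A ** B ** (A ** C) = A ** C"
    using B by (simp add: is_pinv_def matrix_mul_assoc)
  finally have AB: "A ** B = A ** C" using C by (simp add: is_pinv_def)
  have "B ** A = B ** (A ** C ** A)" using C by (simp add: is_pinv_def)
  also have "\<dots> = B ** A ** (C ** A)" by (simp add: matrix_mul_assoc)
  also have "\<dots> = transpose (C ** A ** (B ** A))"
    using B C by (simp add: is_pinv_def matrix_transpose_mul)
  also have "C ** A ** (B ** A) = C ** (A ** B ** A)" by (simp add: matrix_mul_assoc)
  also have "\<dots> = C ** A" using B by (simp add: is_pinv_def)
  finally have BA: "B ** A = C ** A" using C by (simp add: is_pinv_def)
  have "B = B ** (A ** B)" using B by (simp add: is_pinv_def matrix_mul_assoc)
  also have "\<dots> = C ** A ** C" by (simp add: AB BA matrix_mul_assoc)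
  also have "\<dots> = C" using C by (simp add: is_pinv_def)
  finally show ?thesis .
qed

lemma row_space_decomp:
  fixes x :: "real ^ 'c" and A :: "real ^ 'c ^ 'r"
  obtains v where "v \<in> row_space A" "A *v v = A *v x"
proof -
  obtain v z where v: "v \<in> span (rows A)" and z: "\<And>w. w \<in> span (rows A) \<Longrightarrow> orthogonal z w"
    and x: "x = v + z"
    using orthogonal_subspace_decomp_exists[of "rows A" x] by blast
  have "A *v z = 0"
    using z by (intro mult_eq_0_if_orthogonal_row_space) (simp add: row_space_def orthogonal_def)
  with v x show ?thesis
    by (intro that[of v]) (simp_all add: row_space_def matrix_vector_right_distrib)
qed

lemma row_space_inj:
  fixes A :: "real ^ 'c ^ 'r"
  assumes "v \<in> row_space A" "v' \<in> row_space A" "A *v v = A *v v'"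
  shows "v = v'"
proof -
  have "A *v (v - v') = 0" using assms(3) by (simp add: matrix_vector_mult_diff_distrib)
  moreover have "v - v' \<in> row_space A" using assms(1,2) by (simp add: row_space_def span_diff)
  ultimately show ?thesis using inner_row_space_eq_0 by fastforce
qed

text \<open>
  The pseudoinverse sends \<open>w\<close> to the vector \<open>b w\<close> of the row space that \<open>A\<close> maps to the
  projection of \<open>w\<close> onto the column space. Such a vector exists because \<open>A\<close> takes all its
  values on the row space, and is unique because the row space meets the kernel only in zero;
  uniqueness makes \<open>b\<close> linear. Then \<open>A b\<close> and \<open>b A\<close> are the projections onto the column and
  row space, which yields the symmetry conditions.
\<close>

lemma is_pinv_exists:
  fixes A :: "real ^ 'c ^ 'r"
  shows "\<exists>B. is_pinv A B"
proof -
  have "\<exists>v. v \<in> row_space A \<and> (\<forall>u. (w - A *v v) \<bullet> (A *v u) = 0)" for w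
  proof -
    obtain a z where a: "a \<in> span (range ((*v) A))"
      and z: "\<And>b. b \<in> span (range ((*v) A)) \<Longrightarrow> orthogonal z b" and w: "w = a + z"
      using orthogonal_subspace_decomp_exists[of "range ((*v) A)" w] by blast
    have "span (range ((*v) A)) = range ((*v) A)"
      by (simp add: linear_subspace_image)
    with a obtain x where "a = A *v x" by auto
    with row_space_decomp[of A x] obtain v where "v \<in> row_space A" "A *v v = a" by metis
    moreover have "z \<bullet> (A *v u) = 0" for u
      using z[of "A *v u"] by (simp add: orthogonal_def span_base)
    ultimately show ?thesis using w by auto
  qed
  then obtain b where row: "\<And>w. b w \<in> row_space A"
    and orth: "\<And>w u. (w - A *v b w) \<bullet> (A *v u) = 0"
    by metis
  have eqI: "b w = v" if "v \<in> row_space A" "\<And>u. (w - A *v v) \<bullet> (A *v u) = 0" for w v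
  proof (rule row_space_inj[OF row that(1)])
    have "(A *v (b w - v)) \<bullet> (A *v (b w - v)) = 0"
      using orth[of w "b w - v"] that(2)[of "b w - v"]
      by (simp add: matrix_vector_mult_diff_distrib inner_diff_left)
    then show "A *v b w = A *v v" by (simp add: matrix_vector_mult_diff_distrib)
  qed
  have "linear b"
  proof (rule linearI)
    fix w w'
    show "b (w + w') = b w + b w'"
    proof (rule eqI)
      show "b w + b w' \<in> row_space A" using row by (simp add: row_space_def span_add)
      show "(w + w' - A *v (b w + b w')) \<bullet> (A *v u) = 0" for u
        using orth[of w u] orth[of w' u]
        by (simp add: matrix_vector_right_distrib inner_diff_left inner_add_left)
    qed
  next
    fix c :: real and w
    show "b (c *\<^sub>R w) = c *\<^sub>R b w"
    proof (rule eqI)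
      show "c *\<^sub>R b w \<in> row_space A" using row by (simp add: row_space_def span_scale)
      show "(c *\<^sub>R w - A *v (c *\<^sub>R b w)) \<bullet> (A *v u) = 0" for u
        using orth[of w u] by (simp add: matrix_vector_mult_scaleR inner_diff_left)
    qed
  qed
  then have B: "matrix b *v w = b w" for w by (rule matrix_vector_mul(2)[THEN fun_cong])
  have A_b_A: "A *v b (A *v u) = A *v u" for u
    using row_space_decomp[of A u] eqI by (metis cancel_comm_monoid_add_class.diff_cancel inner_zero_left)
  have "A ** matrix b ** A = A"
    by (simp add: matrix_eq A_b_A B flip: matrix_vector_mul_assoc)
  moreover have "matrix b ** A ** matrix b = matrix b"
    using row_space_inj[OF row row A_b_A]
    by (simp add: matrix_eq B flip: matrix_vector_mul_assoc)
  moreover have "transpose (A ** matrix b) = A ** matrix b"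
    unfolding transpose_eq_self_iff
  proof (intro allI)
    fix u w
    have "(A *v b u) \<bullet> w = (A *v b u) \<bullet> (A *v b w)"
      using orth[of w "b u"] by (simp add: inner_diff_left inner_commute inner_diff_right)
    also have "\<dots> = u \<bullet> (A *v b w)" using orth[of u "b w"] by (simp add: inner_diff_left)
    finally show "(A ** matrix b *v u) \<bullet> w = u \<bullet> (A ** matrix b *v w)"
      by (simp add: B flip: matrix_vector_mul_assoc)
  qed
  moreover have "transpose (matrix b ** A) = matrix b ** A"
    unfolding transpose_eq_self_iff
  proof (intro allI)
    fix u w
    have "(u - b (A *v u)) \<bullet> b (A *v w) = 0" "(w - b (A *v w)) \<bullet> b (A *v u) = 0"
      by (rule inner_row_space_eq_0[OF _ row], simp add: matrix_vector_mult_diff_distrib A_b_A)+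
    then show "(matrix b ** A *v u) \<bullet> w = u \<bullet> (matrix b ** A *v w)"
      by (simp add: B inner_diff_left inner_diff_right inner_commute flip: matrix_vector_mul_assoc)
  qed
  ultimately show ?thesis unfolding is_pinv_def by blast
qed

lemma is_pinv_pinv: "is_pinv A (pinv A)"
proof -
  have "pinv A = (THE B. is_pinv A B)" by (simp add: pinv_def is_pinv_def)
  then show ?thesis using theI'[of "is_pinv A"] is_pinv_exists is_pinv_unique by metis
qed

lemma pinv_transpose: "pinv (transpose A) = transpose (pinv A)"
proof (rule is_pinv_unique[OF is_pinv_pinv])
  show "is_pinv (transpose A) (transpose (pinv A))"
    using is_pinv_pinv[of A]
    unfolding is_pinv_def matrix_transpose_mul[symmetric] by (simp add: matrix_mul_assoc)
qed

lemma orthogonal_projection_row_space: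
  "orthogonal_projection (row_space A) x = pinv A *v (A *v x)"
proof -
  define z where "z = pinv A *v (A *v x)"
  have "z = transpose A *v (transpose (pinv A) *v x)"
    using is_pinv_pinv[of A] unfolding z_def is_pinv_def
    by (metis matrix_transpose_mul matrix_vector_mul_assoc)
  then have z: "z \<in> row_space A" by (metis transpose_mult_in_row_space)
  have "A *v z = A *v x"
    using is_pinv_pinv[of A] by (simp add: z_def is_pinv_def matrix_vector_mul_assoc matrix_mul_assoc)
  then have "\<forall>v\<in>row_space A. orthogonal (x - z) v"
    using inner_row_space_eq_0[of A "x - z"]
    by (auto simp: orthogonal_def matrix_vector_mult_diff_distrib)
  moreover have "z' = z"
    if "z' \<in> row_space A" "\<forall>v\<in>row_space A. orthogonal (x - z') v" for z'
  proof (rule row_space_inj[OF that(1) z])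
    have "A *v (x - z') = 0"
      using that(2) by (intro mult_eq_0_if_orthogonal_row_space) (simp add: orthogonal_def)
    with \<open>A *v z = A *v x\<close> show "A *v z' = A *v z" by (simp add: matrix_vector_mult_diff_distrib)
  qed
  ultimately show ?thesis
    unfolding orthogonal_projection_def z_def[symmetric] using z by (intro the_equality) blast+
qed

text \<open>
  Multiplying by \<open>A\<close> undoes \<open>pinv A\<close> on the column space.
\<close>

lemma pinv_mult_eq_iff: "pinv A *v (A *v x) = pinv A *v (A *v x') \<longleftrightarrow> A *v x = A *v x'"
proof
  assume "pinv A *v (A *v x) = pinv A *v (A *v x')"
  then have "(A ** pinv A ** A) *v x = (A ** pinv A ** A) *v x'"
    by (simp flip: matrix_vector_mul_assoc)
  then show "A *v x = A *v x'" using is_pinv_pinv[of A] by (simp add: is_pinv_def)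
qed simp

section \<open>The solution set as a polytope\<close>

lemma subcols_mult: "x \<in> coord_space E \<Longrightarrow> subcols E X *v x = X *v x"
  unfolding vec_eq_iff matrix_vector_mult_def subcols_def coord_space_def
  by (auto intro!: sum.cong)

lemma transpose_subcols_mult:
  "(transpose (subcols E X) *v r) $ i = (if i \<in> E then column i X \<bullet> r else 0)"
  by (simp add: matrix_vector_mult_def transpose_def subcols_def column_def inner_vec_def)

lemma diag_matrix_mult: "(diag_matrix d *v x) $ i = d $ i * x $ i"
  by (simp add: matrix_vector_mult_def diag_matrix_def if_distrib[of "\<lambda>c. c * _"] cong: if_cong)

text \<open>
  With the residual \<open>r\<close> and \<open>A\<close> the restricted matrix, \<open>lam s = A\<^sup>T r\<close>, because the
  correlations in the equicorrelation set have absolute value \<open>lam\<close>. By symmetry of \<open>A A\<^sup>+\<close>,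
  the subtracted term is \<open>A A\<^sup>+ r\<close>, and \<open>A\<^sup>+\<close> does not distinguish it from \<open>r\<close>. What
  remains is \<open>A\<^sup>+ (y - r)\<close>, that is, \<open>A\<^sup>+\<close> of the fitted value.
\<close>

lemma lars_coeffs_eq:
  fixes X :: "real ^ 'p ^ 'n"
  assumes "lasso_solution y X lam \<beta>" "0 \<le> lam"
  defines "XE \<equiv> subcols (equicorrelation_set y X lam) X"
  shows "lars_coeffs y X lam = pinv XE *v (X *v \<beta>)"
proof -
  define s where "s = equicorrelation_signs y X lam"
  define r where "r = y - X *v \<beta>"
  note fit = lasso_fit_eq[OF assms(2,1)]
  have "lam * sgn (column i X \<bullet> r) = column i X \<bullet> r"
    if "i \<in> equicorrelation_set y X lam" for i
    using that by (simp add: equicorrelation_set_def fit r_def abs_mult_sgn flip: mult.commute)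
      (metis abs_mult_sgn)
  then have "lam *\<^sub>R s = transpose XE *v r"
    by (simp add: vec_eq_iff s_def equicorrelation_signs_def Let_def XE_def fit
        transpose_subcols_mult flip: r_def del: transpose_matrix_vector)
  then have "pinv (transpose XE) *v (lam *\<^sub>R s) = transpose (XE ** pinv XE) *v r"
    by (simp add: pinv_transpose matrix_transpose_mul matrix_vector_mul_assoc
        del: transpose_matrix_vector)
  also have "\<dots> = XE *v (pinv XE *v r)"
    using is_pinv_pinv[of XE]
    by (simp add: is_pinv_def matrix_vector_mul_assoc del: transpose_matrix_vector)
  finally have "lars_coeffs y X lam = pinv XE *v (y - XE *v (pinv XE *v r))"
    by (simp only: lars_coeffs_def Let_def XE_def s_def)
  moreover have "pinv XE *v (XE *v (pinv XE *v r)) = pinv XE *v r"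
    using is_pinv_pinv[of XE] by (simp add: is_pinv_def matrix_vector_mul_assoc matrix_mul_assoc)
  ultimately show ?thesis
    by (simp add: matrix_vector_mult_diff_distrib r_def)
qed

text \<open>
  For the fixed fitted value, the complementarity condition at \<open>i\<close> reads
  \<open>g * b = lam * \<bar>b\<bar>\<close> with a constant \<open>g\<close>, where \<open>\<bar>g\<bar> \<le> lam\<close>. If \<open>\<bar>g\<bar> < lam\<close>, it
  forces \<open>b = 0\<close>; if \<open>\<bar>g\<bar> = lam\<close>, it says that \<open>b\<close> does not have the sign opposite
  to \<open>g\<close>.
\<close>

lemma lasso_solution_iff_fixed_fit:
  fixes X :: "real ^ 'p ^ 'n"
  assumes "lasso_solution y X lam \<beta>\<^sub>0" "0 < lam"
  shows "lasso_solution y X lam \<beta> \<longleftrightarrow>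
    \<beta> \<in> coord_space (equicorrelation_set y X lam) \<and> X *v \<beta> = X *v \<beta>\<^sub>0
    \<and> (\<forall>i. 0 \<le> equicorrelation_signs y X lam $ i * \<beta> $ i)"
proof (cases "X *v \<beta> = X *v \<beta>\<^sub>0")
  case True
  define g where "g i = column i X \<bullet> (y - X *v \<beta>\<^sub>0)" for i
  have fit: "lasso_fit y X lam = X *v \<beta>\<^sub>0" using assms by (simp add: lasso_fit_eq)
  have bound: "\<bar>g i\<bar> \<le> lam" for i
    using lasso_solution_imp_kkt[OF assms(1)] assms(2) by (simp add: lasso_kkt_def g_def)
  have E: "i \<in> equicorrelation_set y X lam \<longleftrightarrow> \<bar>g i\<bar> = lam" for i
    by (simp add: equicorrelation_set_def fit g_def)
  have s: "equicorrelation_signs y X lam $ i = (if \<bar>g i\<bar> = lam then sgn (g i) else 0)" for i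
    by (simp add: equicorrelation_signs_def Let_def fit transpose_subcols_mult E g_def
        del: transpose_matrix_vector)
  have "g i * b = lam * \<bar>b\<bar> \<longleftrightarrow>
      (\<bar>g i\<bar> \<noteq> lam \<longrightarrow> b = 0) \<and> 0 \<le> (if \<bar>g i\<bar> = lam then sgn (g i) else 0) * b" for i b
  proof (cases "\<bar>g i\<bar> = lam")
    case True
    then show ?thesis using assms(2) by (auto simp: abs_if sgn_if split: if_splits)
  next
    case False
    with bound[of i] have "\<bar>g i\<bar> < lam" by simp
    then have "b = 0" if "g i * b = lam * \<bar>b\<bar>"
      using that assms(2)
      by (metis abs_mult abs_abs abs_of_pos mult_right_cancel abs_eq_0 less_irrefl)
    with False show ?thesis by auto
  qed
  then show ?thesis
    using True bound assms(2)
    by (auto simp: lasso_solution_iff_kkt lasso_kkt_def coord_space_def E s simp flip: g_def)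
next
  case False
  then show ?thesis using lasso_fit_unique[OF _ assms(1)] assms(2) by auto
qed

lemma lasso_polytope_eq_solutions:
  fixes X :: "real ^ 'p ^ 'n"
  assumes "0 < lam"
  shows "lasso_polytope y X lam = {\<beta>. lasso_solution y X lam \<beta>}"
proof -
  obtain \<beta>\<^sub>0 where sol: "lasso_solution y X lam \<beta>\<^sub>0"
    using lasso_solution_exists[OF assms] by blast
  define E where "E = equicorrelation_set y X lam"
  have "\<beta>\<^sub>0 \<in> coord_space E"
    using sol lasso_solution_iff_fixed_fit[OF sol assms] by (simp add: E_def)
  then have "lars_coeffs y X lam = pinv (subcols E X) *v (subcols E X *v \<beta>\<^sub>0)"
    using sol assms by (simp add: lars_coeffs_eq E_def subcols_mult)
  then have "orthogonal_projection (row_space (subcols E X)) x = lars_coeffs y X lam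
      \<longleftrightarrow> X *v x = X *v \<beta>\<^sub>0" if "x \<in> coord_space E" for x
    using that \<open>\<beta>\<^sub>0 \<in> coord_space E\<close> pinv_mult_eq_iff[of "subcols E X" x \<beta>\<^sub>0]
    by (simp add: orthogonal_projection_row_space subcols_mult)
  then show ?thesis
    unfolding lasso_polytope_def Let_def lasso_solution_iff_fixed_fit[OF sol assms]
    by (auto simp: less_eq_vec_def diag_matrix_mult E_def)
qed

text \<open>
  The characterisation with a fixed fitted value is a finite system of linear equations and
  inequalities. For boundedness, every solution has objective at most the value at zero.
\<close>

lemma polytope_lasso_solutions:
  fixes X :: "real ^ 'p ^ 'n"
  assumes "0 < lam"
  shows "polytope {\<beta>. lasso_solution y X lam \<beta>}"
  unfolding polytope_eq_bounded_polyhedron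
proof
  obtain \<beta>\<^sub>0 where sol: "lasso_solution y X lam \<beta>\<^sub>0"
    using lasso_solution_exists[OF assms] by blast
  define E s where "E = equicorrelation_set y X lam" and "s = equicorrelation_signs y X lam"
  have "affine {\<beta>. \<beta> \<in> coord_space E \<and> X *v \<beta> = X *v \<beta>\<^sub>0}"
    by (auto simp: affine_def coord_space_def matrix_vector_right_distrib
        matrix_vector_mult_scaleR simp flip: scaleR_left_distrib)
  then have "polyhedron {\<beta>. \<beta> \<in> coord_space E \<and> X *v \<beta> = X *v \<beta>\<^sub>0}"
    by (rule affine_imp_polyhedron)
  moreover have "polyhedron (\<Inter>i. {\<beta>. 0 \<le> axis i (s $ i) \<bullet> \<beta>})"
    by (intro polyhedron_Inter) (auto intro: polyhedron_halfspace_ge)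
  ultimately have "polyhedron ({\<beta>. \<beta> \<in> coord_space E \<and> X *v \<beta> = X *v \<beta>\<^sub>0}
      \<inter> (\<Inter>i. {\<beta>. 0 \<le> axis i (s $ i) \<bullet> \<beta>}))"
    by (rule polyhedron_Int)
  also have "\<dots> = {\<beta>. lasso_solution y X lam \<beta>}"
    unfolding lasso_solution_iff_fixed_fit[OF sol assms] E_def s_def
    by (auto simp: inner_axis')
  finally show "polyhedron {\<beta>. lasso_solution y X lam \<beta>}" .
  have "norm \<beta> \<le> lasso_objective y X lam 0 / lam" if "lasso_solution y X lam \<beta>" for \<beta>
  proof -
    have "lam * norm \<beta> \<le> lasso_objective y X lam 0"
      using that norm_le_lasso_objective[of lam \<beta> y X] assms
      unfolding lasso_solution_def by (meson less_imp_le order_trans)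
    then show ?thesis using assms by (simp add: field_simps)
  qed
  then show "bounded {\<beta>. lasso_solution y X lam \<beta>}" by (auto simp: bounded_iff)
qed

text \<open>
  The image is convex and compact, hence an interval \<open>{a..b}\<close>, and it is nonempty because a
  solution exists. So the least and greatest elements that define the bounds are \<open>a\<close> and \<open>b\<close>.
\<close>

lemma image_lasso_polytope_coordinate:
  fixes X :: "real ^ 'p ^ 'n"
  assumes "0 < lam"
  shows "(\<lambda>x. x $ i) ` lasso_polytope y X lam
      = {lasso_lower y X lam i..lasso_upper y X lam i}" (is "?I = _")
    and "lasso_lower y X lam i \<le> lasso_upper y X lam i"
proof -
  have poly: "polytope (lasso_polytope y X lam)"
    using assms by (simp add: lasso_polytope_eq_solutions polytope_lasso_solutions)
  have "linear (\<lambda>x :: real ^ 'p. x $ i)" by (rule bounded_linear.linear[OF bounded_linear_vec_nth])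
  then have "polytope ?I" using poly by (intro polytope_linear_image)
  then have "connected ?I \<and> compact ?I"
    by (simp add: polytope_imp_compact polytope_imp_convex convex_connected)
  then obtain a b where I: "?I = {a..b}" using connected_compact_interval_1 by blast
  have "?I \<noteq> {}" using lasso_solution_exists[OF assms] assms
    by (auto simp: lasso_polytope_eq_solutions)
  with I have "a \<le> b" by auto
  have "lasso_lower y X lam i = a" "lasso_upper y X lam i = b"
    unfolding lasso_lower_def lasso_upper_def I using \<open>a \<le> b\<close>
    by (auto intro!: Least_equality Greatest_equality)
  with I \<open>a \<le> b\<close> show "?I = {lasso_lower y X lam i..lasso_upper y X lam i}"
    "lasso_lower y X lam i \<le> lasso_upper y X lam i" by auto
qed

theorem mainTheorem4:
  fixes y :: "real ^ 'n" and X :: "real ^ 'p ^ 'n" and lam :: real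
  assumes "lam > 0"
  defines "E \<equiv> equicorrelation_set y X lam"
    and "K \<equiv> lasso_polytope y X lam"
    and "lower \<equiv> lasso_lower y X lam"
    and "upper \<equiv> lasso_upper y X lam"
  shows "polytope K
    \<and> {\<beta>. lasso_solution y X lam \<beta>} = {\<beta>. (\<forall>i. i \<notin> E \<longrightarrow> \<beta> $ i = 0) \<and> subvec E \<beta> \<in> K}
    \<and> (\<forall>i\<in>E.
          (\<exists>x\<in>K. x $ i = lower i) \<and> (\<forall>x\<in>K. lower i \<le> x $ i)
        \<and> (\<exists>x\<in>K. x $ i = upper i) \<and> (\<forall>x\<in>K. x $ i \<le> upper i)
        \<and> (\<forall>\<beta>. lasso_solution y X lam \<beta> \<longrightarrow> \<beta> $ i \<in> {lower i..upper i})
        \<and> (\<exists>\<beta>. lasso_solution y X lam \<beta> \<and> \<beta> $ i = lower i)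
        \<and> (\<exists>\<beta>. lasso_solution y X lam \<beta> \<and> \<beta> $ i = upper i)
        \<and> (\<forall>t\<in>{lower i..upper i}. \<exists>\<beta>. lasso_solution y X lam \<beta> \<and> \<beta> $ i = t))"
proof -
  have K: "K = {\<beta>. lasso_solution y X lam \<beta>}"
    using assms(1) by (simp add: K_def lasso_polytope_eq_solutions)
  have "K \<subseteq> coord_space E" by (auto simp: K_def E_def lasso_polytope_def Let_def)
  moreover have "subvec E \<beta> = \<beta>" if "\<beta> \<in> coord_space E" for \<beta>
    using that by (simp add: subvec_def coord_space_def vec_eq_iff)
  ultimately have "\<beta> \<in> K \<longleftrightarrow> (\<forall>i. i \<notin> E \<longrightarrow> \<beta> $ i = 0) \<and> subvec E \<beta> \<in> K" for \<beta>
    by (auto simp: coord_space_def)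
  then have sols: "{\<beta>. lasso_solution y X lam \<beta>}
      = {\<beta>. (\<forall>i. i \<notin> E \<longrightarrow> \<beta> $ i = 0) \<and> subvec E \<beta> \<in> K}"
    unfolding K[symmetric] by blast
  have I: "(\<lambda>x. x $ i) ` K = {lower i..upper i}" and "lower i \<le> upper i" for i
    using image_lasso_polytope_coordinate[OF assms(1)]
    by (simp_all add: K_def lower_def upper_def)
  then have ends: "lower i \<in> {lower i..upper i}" "upper i \<in> {lower i..upper i}" for i
    by simp_all
  have range: "x $ i \<in> {lower i..upper i}" if "x \<in> K" for x i
    using that I by blast
  then have bounds: "lower i \<le> x $ i" "x $ i \<le> upper i" if "x \<in> K" for x i
    using that by (meson atLeastAtMost_iff)+
  have attained: "\<exists>x\<in>K. x $ i = t" if "t \<in> {lower i..upper i}" for t i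
    using that unfolding I[symmetric] by auto
  have mem: "lasso_solution y X lam \<beta> \<longleftrightarrow> \<beta> \<in> K" for \<beta>
    by (simp add: K)
  have "polytope K" unfolding K by (rule polytope_lasso_solutions[OF assms(1)])
  show ?thesis
  proof (intro conjI ballI allI impI)
    show "polytope K" by fact
    show "{\<beta>. lasso_solution y X lam \<beta>}
      = {\<beta>. (\<forall>i. i \<notin> E \<longrightarrow> \<beta> $ i = 0) \<and> subvec E \<beta> \<in> K}" by (fact sols)
    fix i
    show "\<exists>x\<in>K. x $ i = lower i" "\<exists>x\<in>K. x $ i = upper i"
      by (rule attained, rule ends)+
    then show "\<exists>\<beta>. lasso_solution y X lam \<beta> \<and> \<beta> $ i = lower i"
      "\<exists>\<beta>. lasso_solution y X lam \<beta> \<and> \<beta> $ i = upper i"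
      by (auto simp only: mem)
    show "lower i \<le> x $ i" "x $ i \<le> upper i" if "x \<in> K" for x
      using that by (rule bounds)+
    show "\<beta> $ i \<in> {lower i..upper i}" if "lasso_solution y X lam \<beta>" for \<beta>
      using that unfolding mem by (rule range)
    show "\<exists>\<beta>. lasso_solution y X lam \<beta> \<and> \<beta> $ i = t" if "t \<in> {lower i..upper i}" for t
      using attained[OF that] by (auto simp only: mem)
  qed
qed

end
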